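(* There exists an almost complex structure $J$ of class $\mathcal{C}^{1/2}$ on the unit bidisc $\mathbb{D}^2\subset\mathbb{C}^2$ such that the Royden-Kobayashi pseudo-norm of $(\mathbb{D}^2,J)$ is not an upper semi-continuous function on the tangent bundle $T\mathbb{D}^2=\mathbb{D}^2\times\mathbb{R}^4$.
   Context: $\mathbb{D}=\{z\in\mathbb{C}: |z|<1\}$ and, for $r>0$, $\mathbb{D}_r=\{z\in\mathbb{C}: |z|<r\}$. $\mathbb{C}^2$ is identified with $\mathbb{R}^4$ via $z_j=x_j+iy_j$, with coordinates $(x_1,y_1,x_2,y_2)$. An almost complex structure on an open set $X\subset\mathbb{C}^2=\mathbb{R}^4$ is a map $J$ from $X$ to the real $4\times 4$ matrices with $J(p)^2=-\mathbf{1}$ for every $p\in X$. It is of class $\mathcal{C}^{1/2}$ if its entries are (locally) Hölder continuous with exponent $\tfrac12$. A map $Z:\mathbb{D}_r\to X$ of class $\mathcal{C}^1$ is $J$-holomorphic if, with $z=x+iy$, $\frac{\partial Z}{\partial y}(z)=J(Z(z))\,\frac{\partial Z}{\partial x}(z)$ for all $z\in\mathbb{D}_r$. The Royden-Kobayashi pseudo-norm of a tangent vector $V\in\mathbb{R}^4$ at $p\in X$ is $$\inf\Big\{\tfrac1r : r>0 \text{ and there is a } J\text{-holomorphic map } Z:\mathbb{D}_r\to X \text{ with } Z(0)=p,\ \tfrac{\partial Z}{\partial x}(0)=V\Big\}.$$ It is a function on the tangent bundle $X\times\mathbb{R}^4$. (When $J$ is of class $\mathcal{C}^{\alpha}$ for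 some $\alpha>0$, the set over which the infimum is taken is known to be non-empty.) *)

theory Defs
  imports "HOL-Analysis.Analysis"
begin

text \<open>
  \<open>\<complex>\<^sup>2\<close> is modelled as \<^typ>\<open>real^4\<close> with coordinates \<open>(x\<^sub>1, y\<^sub>1, x\<^sub>2, y\<^sub>2)\<close>.
\<close>

definition coord1 :: "real^4 \<Rightarrow> complex" where
  "coord1 p = Complex (p $ 1) (p $ 2)"

definition coord2 :: "real^4 \<Rightarrow> complex" where
  "coord2 p = Complex (p $ 3) (p $ 4)"

definition bidisc :: "(real^4) set" where
  "bidisc = {p. coord1 p \<in> ball 0 1 \<and> coord2 p \<in> ball 0 1}"

text \<open>
  Structures are total functions; their values outside \<open>X\<close> play no role.
\<close>

definition almost_complex_structure :: "(real^4) set \<Rightarrow> (real^4 \<Rightarrow> real^4^4) \<Rightarrow> bool" where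
  "almost_complex_structure X J \<longleftrightarrow> open X \<and> (\<forall>p\<in>X. J p ** J p = - mat 1)"

definition locally_Hoelder_on ::
  "'a::metric_space set \<Rightarrow> real \<Rightarrow> ('a \<Rightarrow> 'b::metric_space) \<Rightarrow> bool" where
  "locally_Hoelder_on X \<alpha> f \<longleftrightarrow>
     (\<forall>p\<in>X. \<exists>\<epsilon>>0. \<exists>C. \<forall>q\<in>X \<inter> ball p \<epsilon>. \<forall>q'\<in>X \<inter> ball p \<epsilon>.
        dist (f q) (f q') \<le> C * dist q q' powr \<alpha>)"

definition Hoelder_structure :: "(real^4) set \<Rightarrow> real \<Rightarrow> (real^4 \<Rightarrow> real^4^4) \<Rightarrow> bool" where
  "Hoelder_structure X \<alpha> J \<longleftrightarrow> (\<forall>i j. locally_Hoelder_on X \<alpha> (\<lambda>p. J p $ i $ j))"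

definition C1_on :: "'a::real_normed_vector set \<Rightarrow> ('a \<Rightarrow> 'b::real_normed_vector) \<Rightarrow> bool" where
  "C1_on S f \<longleftrightarrow>
     (\<exists>f' :: 'a \<Rightarrow> 'a \<Rightarrow>\<^sub>L 'b. continuous_on S f' \<and>
        (\<forall>z\<in>S. (f has_derivative blinfun_apply (f' z)) (at z)))"

text \<open>
  Partial derivatives with respect to \<open>x\<close> and \<open>y\<close>, where \<open>z = x + \<i> y\<close>; they are only
  used at points where the map is differentiable.
\<close>

definition partial_x :: "(complex \<Rightarrow> 'b::real_normed_vector) \<Rightarrow> complex \<Rightarrow> 'b" where
  "partial_x Z z = frechet_derivative Z (at z) 1"

definition partial_y :: "(complex \<Rightarrow> 'b::real_normed_vector) \<Rightarrow> complex \<Rightarrow> 'b" where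
  "partial_y Z z = frechet_derivative Z (at z) \<i>"

definition J_holomorphic ::
  "(real^4) set \<Rightarrow> (real^4 \<Rightarrow> real^4^4) \<Rightarrow> real \<Rightarrow> (complex \<Rightarrow> real^4) \<Rightarrow> bool" where
  "J_holomorphic X J r Z \<longleftrightarrow>
     Z ` ball 0 r \<subseteq> X \<and> C1_on (ball 0 r) Z \<and>
     (\<forall>z\<in>ball 0 r. partial_y Z z = J (Z z) *v partial_x Z z)"

text \<open>
  The infimum is taken in the extended reals, so that the infimum over the empty set
  is \<open>\<infinity>\<close> rather than an unspecified real number.
\<close>

definition royden_kobayashi ::
  "(real^4) set \<Rightarrow> (real^4 \<Rightarrow> real^4^4) \<Rightarrow> real^4 \<Rightarrow> real^4 \<Rightarrow> ereal" where
  "royden_kobayashi X J p V =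
     Inf {ereal (1 / r) | r. r > 0 \<and>
       (\<exists>Z. J_holomorphic X J r Z \<and> Z 0 = p \<and> partial_x Z 0 = V)}"

definition upper_semicontinuous_on ::
  "'a::topological_space set \<Rightarrow> ('a \<Rightarrow> 'b::linorder) \<Rightarrow> bool" where
  "upper_semicontinuous_on S f \<longleftrightarrow>
     (\<forall>x\<in>S. \<forall>c. f x < c \<longrightarrow> eventually (\<lambda>y. f y < c) (at x within S))"

end

theory Submission
  imports Defs "HOL-Complex_Analysis.Complex_Analysis"
begin

text \<open>
  On \<open>\<complex>\<^sup>2\<close> with coordinates \<open>(z, w)\<close> take
  \<open>J(a, b) = (\<i> a, \<i> b - 2 \<i> C \<surd>|w| cnj a)\<close> with a large constant \<open>C\<close>. A map \<open>\<zeta> \<mapsto> (z(\<zeta>), w(\<zeta>))\<close> is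
  \<open>J\<close>-holomorphic iff \<open>z\<close> is holomorphic and \<open>\<partial>w/\<partial>cnj \<zeta> = C \<surd>|w| cnj z'\<close>. The disc \<open>\<zeta> \<mapsto> (\<zeta>, 0)\<close> shows
  that the pseudo-norm of \<open>(1, 0)\<close> at the origin is at most 1. At \<open>(0, \<epsilon>)\<close> with \<open>\<epsilon> \<noteq> 0\<close> it is at
  least 2: on a disc of radius larger than 1/2 with \<open>z'(0) = 1\<close>, Cauchy's estimate keeps \<open>z'\<close> close to 1
  on a disc of fixed radius, and the equation for \<open>w\<close> then forces \<open>|w|\<close> to exceed 1 unless \<open>w(0) = 0\<close>.

  The last claim rests on the scaling \<open>w \<mapsto> w(l \<zeta> / C) / l\<^sup>2\<close> of the equation. Maximising
  \<open>\<surd>|w| - 256 |\<zeta>|\<close> and rescaling around the maximum gives a solution \<open>v\<close> on a disc of radius 603 with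
  \<open>|v| \<le> 1\<close> and \<open>|v(0)| \<ge> 1/2\<close>. But the circle integrals \<open>Re \<integral> v d\<zeta> / \<i>\<close> grow exponentially with the
  radius \<open>s\<close>, since \<open>|v| \<le> \<surd>|v|\<close>, whereas they are bounded by \<open>2 \<pi> s\<close>.
\<close>

subsection \<open>The Cauchy-Riemann operator and circle integrals\<close>

text \<open>The Wirtinger operator: if the real-linear map is
  \<open>L h = a * h + b * cnj h\<close>, this is the coefficient \<open>b\<close>, which measures
  the failure of complex linearity.\<close>

definition dbar :: "(complex \<Rightarrow>\<^sub>L complex) \<Rightarrow> complex" where
  "dbar L = (L 1 + \<i> * L \<i>) / 2"

lemma blinfun_complex_expand:
  fixes L :: "complex \<Rightarrow>\<^sub>L complex"
  shows "L z = of_real (Re z) * L 1 + of_real (Im z) * L \<i>"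
proof -
  have "z = Re z *\<^sub>R 1 + Im z *\<^sub>R \<i>"
    by (simp add: complex_eq_iff)
  then have "L z = L (Re z *\<^sub>R 1 + Im z *\<^sub>R \<i>)"
    by (rule arg_cong)
  also have "\<dots> = Re z *\<^sub>R L 1 + Im z *\<^sub>R L \<i>"
    by (simp only: blinfun.add_right blinfun.scaleR_right)
  finally show ?thesis
    by (simp only: scaleR_conv_of_real)
qed

text \<open>Cauchy-Riemann in polar form: the radial derivative is a \<open>dbar\<close> term plus a
  multiple of an angular derivative, and the latter integrates to zero over a full circle.\<close>

lemma dbar_polar:
  fixes L :: "complex \<Rightarrow>\<^sub>L complex"
  shows "L (cis t) = 2 * cis (- t) * dbar L - \<i> * L (\<i> * cis t)"
  unfolding dbar_def blinfun_complex_expand[of L "cis t"] blinfun_complex_expand[of L "\<i> * cis t"]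
  by (simp add: complex_eq_iff algebra_simps add_divide_distrib diff_divide_distrib)

lemma continuous_on_dbar [continuous_intros]:
  "continuous_on S f \<Longrightarrow> continuous_on S (\<lambda>x. dbar (f x))"
  unfolding dbar_def by (intro continuous_intros) auto

lemma cis_has_vector_derivative:
  "(cis has_vector_derivative \<i> * cis t) (at t within U)"
proof -
  have "((\<lambda>t. of_real (cos t) + \<i> * of_real (sin t)) has_vector_derivative \<i> * cis t) (at t within U)"
    unfolding has_vector_derivative_def
    by (auto intro!: derivative_eq_intros simp: complex_eq_iff fun_eq_iff)
  also have "(\<lambda>t. of_real (cos t) + \<i> * of_real (sin t)) = cis"
    by (simp add: complex_eq_iff fun_eq_iff)
  finally show ?thesis .
qed

context
  fixes v :: "complex \<Rightarrow> complex" and v' :: "complex \<Rightarrow> complex \<Rightarrow>\<^sub>L complex" and T :: real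
  assumes der: "\<And>z. z \<in> ball 0 T \<Longrightarrow> (v has_derivative blinfun_apply (v' z)) (at z)"
    and cont: "continuous_on (ball 0 T) v'"
begin

lemma C1_continuous: "continuous_on (ball 0 T) v"
  by (intro continuous_at_imp_continuous_on ballI has_derivative_continuous[OF der])

lemma polar_continuous:
  "continuous_on ({- T<..<T} \<times> cbox 0 (2 * pi)) (\<lambda>(s, t). v (of_real s * cis t))"
  unfolding case_prod_beta
  by (rule continuous_on_compose2[OF C1_continuous])
     (auto intro!: continuous_intros simp: norm_mult)

lemma polar_deriv_continuous:
  "continuous_on ({- T<..<T} \<times> cbox 0 (2 * pi)) (\<lambda>p. v' (of_real (fst p) * cis (snd p)))"
  by (rule continuous_on_compose2[OF cont])
     (auto intro!: continuous_intros simp: norm_mult)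

lemma circle_continuous:
  assumes "\<bar>s\<bar> < T" shows "continuous_on A (\<lambda>t. v (of_real s * cis t))"
  by (rule continuous_on_compose2[OF C1_continuous])
     (use assms in \<open>auto intro!: continuous_intros simp: norm_mult\<close>)

lemma circle_deriv_continuous:
  assumes "\<bar>s\<bar> < T" shows "continuous_on A (\<lambda>t. v' (of_real s * cis t))"
  by (rule continuous_on_compose2[OF cont])
     (use assms in \<open>auto intro!: continuous_intros simp: norm_mult\<close>)

lemma radial_derivative:
  assumes "\<bar>s\<bar> < T"
  shows "((\<lambda>s. v (of_real s * cis t)) has_vector_derivative v' (of_real s * cis t) (cis t))
    (at s within U)"
proof -
  have "((\<lambda>s. of_real s * cis t) has_vector_derivative cis t) (at s within U)"
    by (auto intro!: derivative_eq_intros simp: has_vector_derivative_def scaleR_conv_of_real)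
  from has_derivative_compose[OF this[unfolded has_vector_derivative_def] der] show ?thesis
    using assms unfolding has_vector_derivative_def
    by (simp add: blinfun.scaleR_right norm_mult)
qed

lemma angular_derivative:
  assumes "\<bar>s\<bar> < T"
  shows "((\<lambda>t. v (of_real s * cis t)) has_vector_derivative
    of_real s * v' (of_real s * cis t) (\<i> * cis t)) (at t within U)"
proof -
  have "(cis has_vector_derivative \<i> * cis t) (at t within U)"
    by (rule cis_has_vector_derivative)
  then have "((\<lambda>t. of_real s * cis t) has_vector_derivative s *\<^sub>R (\<i> * cis t)) (at t within U)"
    by (auto intro!: derivative_eq_intros simp: scaleR_conv_of_real)
  from has_derivative_compose[OF this[unfolded has_vector_derivative_def] der] show ?thesis
    using assms unfolding has_vector_derivative_def
    by (simp only: blinfun.scaleR_right scaleR_conv_of_real[of _ "blinfun_apply _ _"] mem_ball_0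
        norm_mult norm_of_real norm_cis mult_1_right)
qed

lemma circle_mean_deriv_raw:
  assumes "\<bar>s\<bar> < T"
  shows "((\<lambda>s. integral (cbox 0 (2 * pi)) (\<lambda>t. v (of_real s * cis t))) has_vector_derivative
    integral (cbox 0 (2 * pi)) (\<lambda>t. v' (of_real s * cis t) (cis t))) (at s)"
proof -
  have "((\<lambda>s. integral (cbox 0 (2 * pi)) (\<lambda>t. v (of_real s * cis t))) has_vector_derivative
    integral (cbox 0 (2 * pi)) (\<lambda>t. v' (of_real s * cis t) (cis t))) (at s within {- T<..<T})"
  proof (rule leibniz_rule_vector_derivative)
    show "continuous_on ({- T<..<T} \<times> cbox 0 (2 * pi)) (\<lambda>(x, t). v' (of_real x * cis t) (cis t))"
      unfolding case_prod_beta by (intro continuous_intros polar_deriv_continuous)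
    fix x t :: real assume x: "x \<in> {- T<..<T}"
    show "((\<lambda>s. v (of_real s * cis t)) has_vector_derivative v' (of_real x * cis t) (cis t))
      (at x within {- T<..<T})"
      by (rule radial_derivative) (use x in auto)
    show "(\<lambda>t. v (of_real x * cis t)) integrable_on cbox 0 (2 * pi)"
      by (intro integrable_continuous circle_continuous) (use x in auto)
  qed (use assms in auto)
  moreover have "at s within {- T<..<T} = at s"
    by (rule at_within_open) (use assms in auto)
  ultimately show ?thesis
    by simp
qed

text \<open>Differentiation under the integral leaves a radial derivative, which
  \<open>dbar_polar\<close> rewrites. Its angular part is a \<open>t\<close>-derivative only after
  division by \<open>s\<close>, hence \<open>0 < s\<close>.\<close>

lemma circle_mean_deriv:
  assumes "0 < s" "s < T"
  shows "((\<lambda>s. integral (cbox 0 (2 * pi)) (\<lambda>t. v (of_real s * cis t))) has_vector_derivative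
    integral (cbox 0 (2 * pi)) (\<lambda>t. 2 * cis (- t) * dbar (v' (of_real s * cis t)))) (at s)"
proof -
  have s: "\<bar>s\<bar> < T" using assms by auto
  have "((\<lambda>t. of_real s * v' (of_real s * cis t) (\<i> * cis t)) has_integral
    v (of_real s * cis (2 * pi)) - v (of_real s * cis 0)) {0..2 * pi}"
    by (rule fundamental_theorem_of_calculus) (auto intro!: angular_derivative s)
  from has_integral_mult_right[OF this, of "- \<i> / of_real s"] assms
  have 1: "((\<lambda>t. - (\<i> * v' (of_real s * cis t) (\<i> * cis t))) has_integral 0) (cbox 0 (2 * pi))"
    by simp
  have 2: "((\<lambda>t. 2 * cis (- t) * dbar (v' (of_real s * cis t))) has_integral
    integral (cbox 0 (2 * pi)) (\<lambda>t. 2 * cis (- t) * dbar (v' (of_real s * cis t)))) (cbox 0 (2 * pi))"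
    by (intro integrable_integral integrable_continuous continuous_intros circle_deriv_continuous s)
  from has_integral_add[OF 2 1] have "((\<lambda>t. v' (of_real s * cis t) (cis t)) has_integral
    integral (cbox 0 (2 * pi)) (\<lambda>t. 2 * cis (- t) * dbar (v' (of_real s * cis t)))) (cbox 0 (2 * pi))"
    unfolding dbar_polar by simp
  with circle_mean_deriv_raw[OF s] show ?thesis
    by (simp add: integral_unique)
qed

text \<open>Green's formula differentiated in the radius: since d\<zeta> = \<i> \<zeta> dt, the
  integral is the contour integral of \<open>v\<close> divided by \<i>. The weight
  \<open>cis t\<close> cancels the phase \<open>cis (- t)\<close> of \<open>dbar_polar\<close>, so a
  sign condition on \<open>Re (dbar ...)\<close> survives integration. Nothing is divided by
  \<open>s\<close> and negative \<open>s\<close> are allowed, so the formula also holds at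
  0.\<close>

lemma circle_moment_deriv:
  assumes s: "\<bar>s\<bar> < T"
  shows "((\<lambda>s. integral (cbox 0 (2 * pi)) (\<lambda>t. of_real s * cis t * v (of_real s * cis t)))
    has_vector_derivative
    integral (cbox 0 (2 * pi)) (\<lambda>t. 2 * of_real s * dbar (v' (of_real s * cis t)))) (at s)"
proof -
  let ?d = "\<lambda>s t. cis t * v (of_real s * cis t) + of_real s * cis t * v' (of_real s * cis t) (cis t)"
  have 1: "((\<lambda>s. integral (cbox 0 (2 * pi)) (\<lambda>t. of_real s * cis t * v (of_real s * cis t)))
    has_vector_derivative integral (cbox 0 (2 * pi)) (?d s)) (at s within {- T<..<T})"
  proof (rule leibniz_rule_vector_derivative)
    fix x t :: real assume x: "x \<in> {- T<..<T}"
    show "((\<lambda>s. of_real s * cis t * v (of_real s * cis t)) has_vector_derivative ?d x t)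
      (at x within {- T<..<T})"
    proof -
      have "((\<lambda>s. of_real s * cis t) has_vector_derivative cis t) (at x within {- T<..<T})"
        by (auto intro!: derivative_eq_intros simp: has_vector_derivative_def scaleR_conv_of_real)
      moreover have "\<bar>x\<bar> < T" using x by auto
      ultimately show ?thesis
        using has_vector_derivative_mult[OF _ radial_derivative, of "\<lambda>s. of_real s * cis t" "cis t" x "{- T<..<T}" t]
        by (simp add: add.commute)
    qed
    show "(\<lambda>t. of_real x * cis t * v (of_real x * cis t)) integrable_on cbox 0 (2 * pi)"
      by (intro integrable_continuous continuous_intros circle_continuous) (use x in auto)
  next
    show "continuous_on ({- T<..<T} \<times> cbox 0 (2 * pi)) (\<lambda>(x, t). ?d x t)"
      using polar_continuous unfolding case_prod_beta
      by (intro continuous_intros polar_deriv_continuous)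
  qed (use s in auto)
  \<comment> \<open>The angular derivative of \<open>cis t * v\<close> has zero integral over the
    period; multiplied by \<open>- \<i>\<close> it removes everything but the \<open>dbar\<close>
    term from \<open>?d s\<close>.\<close>
  have "((\<lambda>t. \<i> * cis t * v (of_real s * cis t)
      + cis t * (of_real s * v' (of_real s * cis t) (\<i> * cis t))) has_integral
    cis (2 * pi) * v (of_real s * cis (2 * pi)) - cis 0 * v (of_real s * cis 0)) {0..2 * pi}"
  proof (rule fundamental_theorem_of_calculus)
    fix t
    have "(cis has_vector_derivative \<i> * cis t) (at t within {0..2 * pi})"
      by (rule cis_has_vector_derivative)
    from has_vector_derivative_mult[OF this angular_derivative[OF s, of t]]
    show "((\<lambda>t. cis t * v (of_real s * cis t)) has_vector_derivative
      \<i> * cis t * v (of_real s * cis t)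
      + cis t * (of_real s * v' (of_real s * cis t) (\<i> * cis t))) (at t within {0..2 * pi})"
      by (simp add: algebra_simps)
  qed simp
  from has_integral_mult_right[OF this, of "- \<i>"]
  have 2: "((\<lambda>t. cis t * v (of_real s * cis t)
      - \<i> * cis t * (of_real s * v' (of_real s * cis t) (\<i> * cis t))) has_integral 0) (cbox 0 (2 * pi))"
    by (simp add: algebra_simps cis_2pi[unfolded mult.commute[of 2]])
  have 3: "((\<lambda>t. 2 * of_real s * dbar (v' (of_real s * cis t))) has_integral
    integral (cbox 0 (2 * pi)) (\<lambda>t. 2 * of_real s * dbar (v' (of_real s * cis t)))) (cbox 0 (2 * pi))"
    by (intro integrable_integral integrable_continuous continuous_intros circle_deriv_continuous s)
  from has_integral_add[OF 2 3] have "((\<lambda>t. cis t * v (of_real s * cis t)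
      - \<i> * cis t * (of_real s * v' (of_real s * cis t) (\<i> * cis t))
      + 2 * of_real s * dbar (v' (of_real s * cis t))) has_integral
    integral (cbox 0 (2 * pi)) (\<lambda>t. 2 * of_real s * dbar (v' (of_real s * cis t)))) (cbox 0 (2 * pi))"
    by simp
  also have "(\<lambda>t. cis t * v (of_real s * cis t)
      - \<i> * cis t * (of_real s * v' (of_real s * cis t) (\<i> * cis t))
      + 2 * of_real s * dbar (v' (of_real s * cis t))) = ?d s"
  proof
    fix t
    have "cis t * (2 * cis (- t) * d - \<i> * l) = 2 * (cis t * cis (- t)) * d - \<i> * cis t * l"
      for d l by (simp add: right_diff_distrib mult_ac)
    then have "cis t * v' (of_real s * cis t) (cis t)
      = 2 * dbar (v' (of_real s * cis t)) - \<i> * cis t * v' (of_real s * cis t) (\<i> * cis t)"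
      unfolding dbar_polar by (simp add: cis_mult)
    then have "of_real s * cis t * v' (of_real s * cis t) (cis t) = of_real s *
        (2 * dbar (v' (of_real s * cis t)) - \<i> * cis t * v' (of_real s * cis t) (\<i> * cis t))"
      by (simp only: mult.assoc)
    then show "cis t * v (of_real s * cis t)
      - \<i> * cis t * (of_real s * v' (of_real s * cis t) (\<i> * cis t))
      + 2 * of_real s * dbar (v' (of_real s * cis t)) = ?d s t"
      by (simp add: algebra_simps)
  qed
  finally have "integral (cbox 0 (2 * pi)) (?d s) =
    integral (cbox 0 (2 * pi)) (\<lambda>t. 2 * of_real s * dbar (v' (of_real s * cis t)))"
    by (rule integral_unique)
  moreover have "at s within {- T<..<T} = at s"
    by (rule at_within_open) (use s in auto)
  ultimately show ?thesis
    using 1 by simp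
qed

end

subsection \<open>Solutions of the inequality with a square root\<close>

text \<open>For the real moment \<open>N\<close> of \<open>v\<close> and the circle integrals
  \<open>A\<close> of \<open>|v|\<close> and \<open>m\<close> of its square root,
  \<open>N \<le> s * A \<le> s * m \<le> N'\<close>, because \<open>|v| \<le> 1\<close>. So
  \<open>N\<close> grows at least exponentially once positive, yet
  \<open>N \<le> 2 * pi * s\<close>. The value at the centre supplies an explicit positive lower
  bound for \<open>N 1\<close>.\<close>

lemma dbar_sqrt_radius_le:
  fixes v :: "complex \<Rightarrow> complex" and v' :: "complex \<Rightarrow> complex \<Rightarrow>\<^sub>L complex"
  assumes der: "\<And>z. z \<in> ball 0 T \<Longrightarrow> (v has_derivative blinfun_apply (v' z)) (at z)"
    and cont: "continuous_on (ball 0 T) v'"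
    and bound: "\<And>z. z \<in> ball 0 T \<Longrightarrow> cmod (v z) \<le> 1"
    and lower: "\<And>z. z \<in> ball 0 T \<Longrightarrow> sqrt (cmod (v z)) / 2 \<le> Re (dbar (v' z))"
    and upper: "\<And>z. z \<in> ball 0 T \<Longrightarrow> cmod (dbar (v' z)) \<le> 3 / 2 * sqrt (cmod (v z))"
    and centre: "1 / 2 \<le> cmod (v 0)"
  shows "T \<le> 602"
proof (rule ccontr)
  assume "\<not> T \<le> 602"
  then have T: "602 < T" by simp
  let ?I = "cbox 0 (2 * pi)"
  note cv = circle_continuous[OF der cont] and cv' = circle_deriv_continuous[OF der cont]
  have pt: "of_real s * cis t \<in> ball 0 T" if "\<bar>s\<bar> < T" for s t
    using that by (simp add: norm_mult)
  \<comment> \<open>\<open>G\<close> integrates \<open>m\<close> without the polar weight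
    \<open>s\<close>, as the derivative of \<open>M\<close> demands; the derivative of
    \<open>N\<close> does carry that weight.\<close>
  define m where "m s = integral ?I (\<lambda>t. sqrt (cmod (v (of_real s * cis t))))" for s
  define A where "A s = integral ?I (\<lambda>t. cmod (v (of_real s * cis t)))" for s
  define M where "M s = integral ?I (\<lambda>t. v (of_real s * cis t))" for s
  define N where "N s = Re (integral ?I (\<lambda>t. of_real s * cis t * v (of_real s * cis t)))" for s
  define G where "G s = integral {0..s} m" for s

  have int_m: "(\<lambda>t. sqrt (cmod (v (of_real s * cis t)))) integrable_on ?I" if "\<bar>s\<bar> < T" for s
    by (intro integrable_continuous continuous_intros cv that)
  have int_A: "(\<lambda>t. cmod (v (of_real s * cis t))) integrable_on ?I" if "\<bar>s\<bar> < T" for s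
    by (intro integrable_continuous continuous_intros cv that)
  have int_d: "(\<lambda>t. dbar (v' (of_real s * cis t))) integrable_on ?I" if "\<bar>s\<bar> < T" for s
    by (intro integrable_continuous continuous_intros cv' that)
  have m_nonneg: "0 \<le> m s" if "\<bar>s\<bar> < T" for s
    unfolding m_def by (intro integral_nonneg int_m that) auto
  have m_le: "m s \<le> 2 * pi" if "\<bar>s\<bar> < T" for s
  proof -
    have "m s \<le> integral ?I (\<lambda>t. 1)"
      unfolding m_def using bound[OF pt[OF that]] by (intro integral_le int_m that) auto
    then show ?thesis by simp
  qed
  have A_le_m: "A s \<le> m s" if "\<bar>s\<bar> < T" for s
    unfolding A_def m_def
  proof (intro integral_le int_m int_A that)
    fix t
    from bound[OF pt[OF that, of t]] show "cmod (v (of_real s * cis t)) \<le> sqrt (cmod (v (of_real s * cis t)))"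
      by (intro real_le_rsqrt) (simp add: power2_eq_square mult_left_le)
  qed
  have cont_m: "continuous_on {- T<..<T} m"
    unfolding m_def
    by (rule integral_continuous_on_param)
       (use polar_continuous[OF der cont] in \<open>auto intro!: continuous_intros simp: case_prod_beta simp del: box_real\<close>)
  have cont_m': "continuous_on {0..602} m"
    by (rule continuous_on_subset[OF cont_m]) (use T in auto)
  have DG: "(G has_real_derivative m s) (at s within {0..602})" if "s \<in> {0..602}" for s
    unfolding G_def by (rule integral_has_real_derivative[OF cont_m' that])
  have DG': "(G has_real_derivative m s) (at s)" if "0 < s" "s < 602" for s
    using DG[of s] that at_within_Icc_at[of 0 s 602] by auto
  have cont_G: "continuous_on {0..602} G"
    by (rule DERIV_continuous_on[OF DG])
  have G0: "G 0 = 0" by (simp add: G_def)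
  have G_mono: "G a \<le> G b" if "0 \<le> a" "a \<le> b" "b \<le> 602" for a b
  proof (rule DERIV_nonneg_imp_increasing_open[OF that(2)])
    show "\<exists>y. (G has_real_derivative y) (at x) \<and> 0 \<le> y" if "a < x" "x < b" for x
      using DG'[of x] m_nonneg[of x] that \<open>0 \<le> a\<close> \<open>b \<le> 602\<close> T by auto
    show "continuous_on {a..b} G"
      by (rule continuous_on_subset[OF cont_G]) (use that in auto)
  qed
  have G_le: "G a \<le> 2 * pi * a" if "0 \<le> a" "a \<le> 602" for a
  proof -
    have "2 * pi * 0 - G 0 \<le> 2 * pi * a - G a"
    proof (rule DERIV_nonneg_imp_increasing_open[where f = "\<lambda>x. 2 * pi * x - G x", OF that(1)])
      fix x assume x: "0 < x" "x < a"
      have "((\<lambda>x. 2 * pi * x - G x) has_real_derivative 2 * pi - m x) (at x)"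
        by (auto intro!: derivative_eq_intros DG') (use x that in auto)
      then show "\<exists>y. ((\<lambda>x. 2 * pi * x - G x) has_real_derivative y) (at x) \<and> 0 \<le> y"
        using m_le[of x] x that T by auto
    qed (intro continuous_intros continuous_on_subset[OF cont_G], use that in auto)
    then show ?thesis using G0 by simp
  qed

  \<comment> \<open>\<open>v(0)\<close> is recovered from the mean of \<open>v\<close> over a circle up to the integral of \<open>\<surd>|v|\<close> over the disc.\<close>
  have m_G: "pi \<le> m s + 3 * G s" if s: "0 \<le> s" "s < 602" for s
  proof -
    \<comment> \<open>Rotation by \<open>e\<close> makes \<open>v 0\<close> a positive real, so that
      real parts of means suffice.\<close>
    define e where "e = cnj (sgn (v 0))"
    have v0: "v 0 \<noteq> 0" using centre by auto
    have e: "cmod e = 1" using v0 by (simp add: e_def norm_sgn)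
    have ev: "e * v 0 = of_real (cmod (v 0))"
    proof -
      have "cnj (v 0) * v 0 = of_real (cmod (v 0)) * of_real (cmod (v 0))"
        using complex_norm_square[of "v 0"] by (simp only: power2_eq_square of_real_mult mult.commute[of "cnj _"])
      then show ?thesis using v0 by (simp add: e_def sgn_eq)
    qed
    \<comment> \<open>By \<open>upper\<close>, the derivative of \<open>M\<close> has modulus at
      most \<open>3 * m\<close>, which is the derivative of \<open>3 * G\<close>; so
      \<open>?f\<close> cannot decrease. That derivative is known only for positive radii, whence
      monotonicity from the open interval and continuity.\<close>
    let ?f = "\<lambda>s. Re (e * M s) + 3 * G s"
    have "?f 0 \<le> ?f s"
    proof (rule DERIV_nonneg_imp_increasing_open[where f = ?f, OF s(1)])
      fix x assume x: "0 < x" "x < s"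
      let ?D = "integral ?I (\<lambda>t. 2 * cis (- t) * dbar (v' (of_real x * cis t)))"
      have xT: "\<bar>x\<bar> < T" using x s T by auto
      have "(M has_vector_derivative ?D) (at x)"
        unfolding M_def by (rule circle_mean_deriv[OF der cont]) (use x s T in auto)
      then have "((\<lambda>x. e * M x) has_vector_derivative e * ?D) (at x)"
        by (auto intro!: derivative_eq_intros)
      then have "((\<lambda>x. Re (e * M x)) has_real_derivative Re (e * ?D)) (at x)"
        unfolding has_real_derivative_iff_has_vector_derivative
        by (rule bounded_linear.has_vector_derivative[OF bounded_linear_Re])
      then have "(?f has_real_derivative Re (e * ?D) + 3 * m x) (at x)"
        by (rule DERIV_add[OF _ DERIV_cmult[OF DG']]) (use x s in auto)
      moreover have "cmod ?D \<le> integral ?I (\<lambda>t. 3 * sqrt (cmod (v (of_real x * cis t))))"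
      proof (rule integral_norm_bound_integral)
        show "(\<lambda>t. 2 * cis (- t) * dbar (v' (of_real x * cis t))) integrable_on ?I"
          by (intro integrable_continuous continuous_intros cv' xT)
        show "(\<lambda>t. 3 * sqrt (cmod (v (of_real x * cis t)))) integrable_on ?I"
          by (intro integrable_continuous continuous_intros cv xT)
        show "cmod (2 * cis (- t) * dbar (v' (of_real x * cis t))) \<le> 3 * sqrt (cmod (v (of_real x * cis t)))" for t
          using upper[OF pt[OF xT, of t]] by (simp add: norm_mult)
      qed
      then have "cmod (e * ?D) \<le> 3 * m x"
        using e by (simp add: m_def norm_mult)
      then have "0 \<le> Re (e * ?D) + 3 * m x"
        using abs_Re_le_cmod[of "e * ?D"] by linarith
      ultimately show "\<exists>y. (?f has_real_derivative y) (at x) \<and> 0 \<le> y"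
        by blast
    next
      have "continuous_on {0..s} M"
        unfolding M_def
        by (rule integral_continuous_on_param[OF continuous_on_subset[OF polar_continuous[OF der cont]]])
           (use s T in auto)
      then show "continuous_on {0..s} ?f"
        by (intro continuous_intros continuous_on_subset[OF cont_G]) (use s in auto)
    qed
    moreover have "M 0 = 2 * pi * v 0"
      by (simp add: M_def scaleR_conv_of_real)
    then have "Re (e * M 0) = 2 * pi * cmod (v 0)"
      using ev by (metis Re_complex_of_real mult.left_commute of_real_mult of_real_numeral)
    moreover have "cmod (M s) \<le> A s"
      unfolding M_def A_def
      by (rule integral_norm_bound_integral) (use s T in \<open>auto intro!: integrable_continuous cv int_A simp del: box_real\<close>)
    then have "Re (e * M s) \<le> A s"
      using complex_Re_le_cmod[of "e * M s"] e by (simp add: norm_mult)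
    moreover have "pi * 1 \<le> pi * (2 * cmod (v 0))"
      using centre by (intro mult_left_mono) auto
    moreover have "A s \<le> m s"
      by (rule A_le_m) (use s T in auto)
    ultimately show ?thesis
      using G0 by linarith
  qed

  \<comment> \<open>On the unit interval \<open>G \<le> G 1\<close>, so
    \<open>m \<ge> pi - 3 * G 1\<close> there; integration gives
    \<open>G 1 \<ge> pi - 3 * G 1\<close>.\<close>
  have G1: "pi / 4 \<le> G 1"
  proof -
    have "G 0 - (pi - 3 * G 1) * 0 \<le> G 1 - (pi - 3 * G 1) * 1"
    proof (rule DERIV_nonneg_imp_increasing_open[where f = "\<lambda>x. G x - (pi - 3 * G 1) * x"])
      fix x :: real assume x: "0 < x" "x < 1"
      have "((\<lambda>x. G x - (pi - 3 * G 1) * x) has_real_derivative m x - (pi - 3 * G 1)) (at x)"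
        by (auto intro!: derivative_eq_intros DG') (use x in auto)
      moreover have "0 \<le> m x - (pi - 3 * G 1)"
        using m_G[of x] G_mono[of x 1] x by auto
      ultimately show "\<exists>y. ((\<lambda>x. G x - (pi - 3 * G 1) * x) has_real_derivative y) (at x) \<and> 0 \<le> y"
        by blast
    qed (auto intro!: continuous_intros continuous_on_subset[OF cont_G])
    then show ?thesis using G0 by simp
  qed

  \<comment> \<open>The factor 2 in the moment derivative cancels the 1/2 in
    \<open>lower\<close>.\<close>
  have N_deriv: "\<exists>y. (N has_real_derivative y) (at s) \<and> s * m s \<le> y" if s: "0 \<le> s" "s < T" for s
  proof -
    have s': "\<bar>s\<bar> < T" using s by auto
    let ?D = "integral ?I (\<lambda>t. 2 * of_real s * dbar (v' (of_real s * cis t)))"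
    have "(N has_real_derivative Re ?D) (at s)"
      unfolding N_def has_real_derivative_iff_has_vector_derivative
      by (rule bounded_linear.has_vector_derivative[OF bounded_linear_Re circle_moment_deriv[OF der cont s']])
    moreover have "Re ?D = integral ?I (\<lambda>t. Re (2 * of_real s * dbar (v' (of_real s * cis t))))"
      by (rule integral_linear[OF integrable_on_mult_right[OF int_d[OF s'], of "2 * of_real s"]
            bounded_linear_Re, unfolded o_def, symmetric])
    moreover have "s * m s = integral ?I (\<lambda>t. s * sqrt (cmod (v (of_real s * cis t))))"
      by (simp add: m_def)
    moreover have "\<dots> \<le> integral ?I (\<lambda>t. Re (2 * of_real s * dbar (v' (of_real s * cis t))))"
    proof (rule integral_le)
      show "(\<lambda>t. s * sqrt (cmod (v (of_real s * cis t)))) integrable_on ?I"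
        by (intro integrable_continuous continuous_intros cv s')
      show "(\<lambda>t. Re (2 * of_real s * dbar (v' (of_real s * cis t)))) integrable_on ?I"
        by (rule integrable_linear[OF integrable_on_mult_right[OF int_d[OF s'], of "2 * of_real s"]
              bounded_linear_Re, unfolded o_def])
      show "s * sqrt (cmod (v (of_real s * cis t))) \<le> Re (2 * of_real s * dbar (v' (of_real s * cis t)))" for t
        using mult_left_mono[OF lower[OF pt[OF s', of t]] s(1)] by (simp add: algebra_simps)
    qed
    ultimately show ?thesis by auto
  qed
  have N_le: "N s \<le> s * A s" if s: "0 \<le> s" "s < T" for s
  proof -
    have s': "\<bar>s\<bar> < T" using s by auto
    have "N s \<le> cmod (integral ?I (\<lambda>t. of_real s * cis t * v (of_real s * cis t)))"
      unfolding N_def by (rule complex_Re_le_cmod)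
    also have "cmod (integral ?I (\<lambda>t. of_real s * cis t * v (of_real s * cis t))) \<le>
      integral ?I (\<lambda>t. s * cmod (v (of_real s * cis t)))"
    proof (rule integral_norm_bound_integral)
      show "(\<lambda>t. of_real s * cis t * v (of_real s * cis t)) integrable_on ?I"
        by (intro integrable_continuous continuous_intros cv s')
      show "(\<lambda>t. s * cmod (v (of_real s * cis t))) integrable_on ?I"
        by (intro integrable_continuous continuous_intros cv s')
    qed (use s in \<open>auto simp: norm_mult\<close>)
    finally show ?thesis
      by (simp add: A_def)
  qed

  \<comment> \<open>The weight \<open>s\<close> is at least 1/16 beyond radius 1/16, and the part of
    \<open>G\<close> below that radius is at most \<open>pi / 8\<close>, half of the bound in
    \<open>G1\<close>. What remains is \<open>(pi / 4 - pi / 8) / 16\<close>.\<close>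
  have N1: "pi / 128 \<le> N 1"
  proof -
    have "N 0 \<le> N (1/16)"
    proof (rule DERIV_nonneg_imp_nondecreasing[where f = N])
      fix x :: real assume x: "0 \<le> x" "x \<le> 1/16"
      then have "0 \<le> x * m x" using m_nonneg[of x] T by auto
      then show "\<exists>y. (N has_real_derivative y) (at x) \<and> 0 \<le> y"
        using N_deriv[of x] x T by force
    qed simp
    moreover have "N 0 = 0" by (simp add: N_def)
    moreover have "N (1/16) - G (1/16) / 16 \<le> N 1 - G 1 / 16"
    proof (rule DERIV_nonneg_imp_nondecreasing[where f = "\<lambda>x. N x - G x / 16"])
      fix x :: real assume x: "1/16 \<le> x" "x \<le> 1"
      obtain y where y: "(N has_real_derivative y) (at x)" "x * m x \<le> y"
        using N_deriv[of x] x T by auto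
      have "((\<lambda>x. N x - G x / 16) has_real_derivative y - m x / 16) (at x)"
        by (auto intro!: derivative_eq_intros DG' y) (use x in auto)
      moreover have "1/16 * m x \<le> x * m x"
        using x m_nonneg[of x] T by (intro mult_right_mono) auto
      ultimately show "\<exists>y. ((\<lambda>x. N x - G x / 16) has_real_derivative y) (at x) \<and> 0 \<le> y"
        using y(2) by force
    qed simp
    ultimately show ?thesis
      using G1 G_le[of "1/16"] by simp
  qed

  \<comment> \<open>Gronwall's argument for \<open>N \<le> N'\<close>.\<close>
  have "N 1 * exp (- 1) \<le> N 601 * exp (- 601)"
  proof (rule DERIV_nonneg_imp_nondecreasing[where f = "\<lambda>s. N s * exp (- s)"])
    fix x :: real assume x: "1 \<le> x" "x \<le> 601"
    obtain y where y: "(N has_real_derivative y) (at x)" "x * m x \<le> y"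
      using N_deriv[of x] x T by auto
    have "((\<lambda>s. N s * exp (- s)) has_real_derivative (y - N x) * exp (- x)) (at x)"
      by (auto intro!: derivative_eq_intros y simp: algebra_simps)
    moreover have "N x \<le> x * m x"
      using N_le[of x] mult_left_mono[OF A_le_m[of x], of x] x T by linarith
    ultimately show "\<exists>y. ((\<lambda>s. N s * exp (- s)) has_real_derivative y) (at x) \<and> 0 \<le> y"
      using y(2) by fastforce
  qed simp
  then have "N 1 * exp (- 1) * exp 601 \<le> N 601 * exp (- 601) * exp 601"
    by (intro mult_right_mono) auto
  then have "N 1 * exp 600 \<le> N 601"
    by (simp add: mult.assoc flip: exp_add)
  also have "N 601 \<le> 601 * m 601"
    using N_le[of 601] A_le_m[of 601] T by auto
  also have "\<dots> \<le> 1202 * pi"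
    using m_le[of 601] T by simp
  finally have "N 1 * exp 600 \<le> 1202 * pi" .
  \<comment> \<open>\<open>180601 = 1 + 600 + 600^2 / 2\<close>. The radius is large enough for this
    quadratic bound to suffice: 180601 / 128 exceeds 1202.\<close>
  moreover have "pi / 128 * 180601 \<le> N 1 * exp 600"
    using N1 exp_lower_Taylor_quadratic[of "600::real"]
    by (intro mult_mono) (auto intro: order_trans[of _ "pi / 128"])
  ultimately show False
    using pi_gt_zero by linarith
qed

section \<open>Localisation by rescaling around a penalised maximum\<close>

lemma dbar_scaleR: "dbar (c *\<^sub>R L) = c *\<^sub>R dbar L"
  by (simp add: dbar_def scaleR_blinfun.rep_eq scaleR_conv_of_real algebra_simps)

text \<open>The equation is invariant under a scaling that enlarges the disc when \<open>w\<close>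
  is small. A nonzero \<open>w 0\<close> would yield a rescaled solution on a disc too large for
  \<open>dbar_sqrt_radius_le\<close>. Rescaling at 0 itself could leave \<open>|v|\<close> unbounded
  by 1, so a maximum point is used as the new centre.\<close>

lemma dbar_sqrt_zero_at_centre:
  fixes w :: "complex \<Rightarrow> complex" and w' :: "complex \<Rightarrow> complex \<Rightarrow>\<^sub>L complex"
  assumes der: "\<And>z. z \<in> ball 0 (1/64) \<Longrightarrow> (w has_derivative blinfun_apply (w' z)) (at z)"
    and cont: "continuous_on (ball 0 (1/64)) w'"
    and bound: "\<And>z. z \<in> ball 0 (1/64) \<Longrightarrow> cmod (w z) \<le> 1"
    and lower: "\<And>z. z \<in> ball 0 (1/64) \<Longrightarrow> 10^6 * sqrt (cmod (w z)) / 2 \<le> Re (dbar (w' z))"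
    and upper: "\<And>z. z \<in> ball 0 (1/64) \<Longrightarrow> cmod (dbar (w' z)) \<le> 3 / 2 * (10^6 * sqrt (cmod (w z)))"
  shows "w 0 = 0"
proof (rule ccontr)
  assume w0: "w 0 \<noteq> 0"
  have "continuous_on (cball 0 (1/128)) w"
    by (intro continuous_at_imp_continuous_on ballI has_derivative_continuous[OF der]) auto
  \<comment> \<open>Comparing the maximum with the value at 0 gives
    \<open>256 * cmod a < q \<le> 1\<close>, so the penalty keeps \<open>a\<close> within 1/256 of
    the centre. It also bounds the growth of the square root of \<open>|w|\<close> away from
    \<open>a\<close> by the rate 256.\<close>
  then have "continuous_on (cball 0 (1/128)) (\<lambda>z. sqrt (cmod (w z)) - 256 * cmod z)"
    by (intro continuous_intros)
  from continuous_attains_sup[OF compact_cball _ this]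
  obtain a where a: "a \<in> cball 0 (1/128)" and max:
    "\<And>z. z \<in> cball 0 (1/128) \<Longrightarrow> sqrt (cmod (w z)) - 256 * cmod z \<le> sqrt (cmod (w a)) - 256 * cmod a"
    by auto
  define q where "q = sqrt (cmod (w a))"
  have wa: "cmod (w a) = q\<^sup>2" by (simp add: q_def)
  have "0 < sqrt (cmod (w 0))" using w0 by simp
  moreover have "sqrt (cmod (w 0)) \<le> q - 256 * cmod a"
    using max[of 0] by (simp add: q_def)
  ultimately have qa: "256 * cmod a < q" by linarith
  then have q: "0 < q" using norm_ge_zero[of a] by linarith
  have "q \<le> 1" using bound[of a] a by (simp add: q_def)
  \<comment> \<open>\<open>4/3 = 1 + 256/768\<close>: on the disc of radius \<open>q/768\<close> around \<open>a\<close> the maximality of \<open>a\<close> gives \<open>\<surd>|w| \<le> l\<close>.\<close>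
  define l where "l = 4 / 3 * q"
  \<comment> \<open>The rescaling multiplies \<open>dbar\<close> by \<open>c / l^2\<close> and the
    square root by \<open>1 / l\<close>; the coefficient \<open>10^6\<close> thus becomes
    \<open>10^6 * c / l\<close>, which is 1 for this \<open>c\<close>.\<close>
  define c where "c = l / 10^6"
  have l: "0 < l" and c: "0 < c" using q by (auto simp: l_def c_def)
  \<comment> \<open>Here the size of \<open>10^6\<close> enters: a disc of radius 603, just above
    the critical 602, fits after scaling into the controlled disc around \<open>a\<close>.\<close>
  have c603: "c * 603 \<le> q / 768" using q by (simp add: c_def l_def)
  have near: "a + of_real c * z \<in> ball 0 (1/64)" and grow: "sqrt (cmod (w (a + of_real c * z))) \<le> l"
    if "z \<in> ball 0 603" for z
  proof -
    have "cmod (of_real c * z) \<le> c * 603"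
      using that c by (simp add: norm_mult)
    then have 1: "cmod (of_real c * z) \<le> q / 768" using c603 by linarith
    then have 2: "cmod (a + of_real c * z) \<le> 1/128"
      using norm_triangle_ineq[of a "of_real c * z"] qa \<open>q \<le> 1\<close> by linarith
    then show "a + of_real c * z \<in> ball 0 (1/64)" by simp
    have "sqrt (cmod (w (a + of_real c * z))) \<le> q + 256 * (cmod (a + of_real c * z) - cmod a)"
      using max[of "a + of_real c * z"] 2 by (simp add: q_def)
    also have "\<dots> \<le> l"
      using norm_triangle_ineq[of a "of_real c * z"] 1 by (simp add: l_def)
    finally show "sqrt (cmod (w (a + of_real c * z))) \<le> l" .
  qed
  define v where "v z = w (a + of_real c * z) / of_real (l\<^sup>2)" for z
  define v' where "v' z = (c / l\<^sup>2) *\<^sub>R w' (a + of_real c * z)" for z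
  have dv: "dbar (v' z) = (1 / (10^6 * l)) *\<^sub>R dbar (w' (a + of_real c * z))" for z
    unfolding v'_def dbar_scaleR c_def using l by (simp add: power2_eq_square)
  have sv: "sqrt (cmod (v z)) = sqrt (cmod (w (a + of_real c * z))) / l" for z
    using l by (simp add: v_def norm_divide real_sqrt_divide norm_power)
  have "(603::real) \<le> 602"
  proof (rule dbar_sqrt_radius_le)
    fix z :: complex assume z: "z \<in> ball 0 603"
    have "((\<lambda>z. a + of_real c * z) has_derivative (\<lambda>h. c *\<^sub>R h)) (at z)"
      by (auto intro!: derivative_eq_intros simp: scaleR_conv_of_real)
    from has_derivative_compose[OF this der[OF near[OF z]]]
    have "((\<lambda>z. (1 / l\<^sup>2) *\<^sub>R w (a + of_real c * z)) has_derivative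
      (\<lambda>h. (1 / l\<^sup>2) *\<^sub>R w' (a + of_real c * z) (c *\<^sub>R h))) (at z)"
      by (rule has_derivative_scaleR_right)
    moreover have "v = (\<lambda>z. (1 / l\<^sup>2) *\<^sub>R w (a + of_real c * z))"
      by (simp add: fun_eq_iff v_def scaleR_conv_of_real)
    moreover have "blinfun_apply (v' z) = (\<lambda>h. (1 / l\<^sup>2) *\<^sub>R w' (a + of_real c * z) (c *\<^sub>R h))"
      by (simp add: fun_eq_iff v'_def scaleR_blinfun.rep_eq blinfun.scaleR_right)
    ultimately show "(v has_derivative blinfun_apply (v' z)) (at z)"
      by simp
    have "sqrt (cmod (v z)) \<le> 1"
      using grow[OF z] l by (simp add: sv divide_le_eq)
    then show "cmod (v z) \<le> 1"
      by simp
    show "sqrt (cmod (v z)) / 2 \<le> Re (dbar (v' z))"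
      using lower[OF near[OF z]] l unfolding sv dv by (simp add: field_simps)
    show "cmod (dbar (v' z)) \<le> 3 / 2 * sqrt (cmod (v z))"
      using upper[OF near[OF z]] l unfolding sv dv by (simp add: field_simps)
  next
    show "continuous_on (ball 0 603) v'"
      unfolding v'_def
      by (intro continuous_intros continuous_on_compose2[OF cont]) (use near in auto)
    \<comment> \<open>The value is \<open>(q / l)^2 = 9 / 16\<close>.\<close>
    show "1 / 2 \<le> cmod (v 0)"
      using q by (simp add: v_def norm_divide norm_power wa l_def power_mult_distrib power_divide)
  qed
  then show False by simp
qed

subsection \<open>The almost complex structure\<close>

text \<open>The real matrix of \<open>(a, b) \<mapsto> (\<i> a, \<i> b - \<i> k cnj a)\<close> with \<open>k = skew p\<close>, so \<open>C = 10^6\<close>.\<close>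

definition skew :: "real^4 \<Rightarrow> real" where
  "skew p = 2 * 10^6 * sqrt (cmod (coord2 p))"

definition J\<^sub>0 :: "real^4 \<Rightarrow> real^4^4" where
  "J\<^sub>0 p = vector [vector [0, -1, 0, 0], vector [1, 0, 0, 0],
     vector [0, - skew p, 0, -1], vector [- skew p, 0, 1, 0]]"

lemma vector_4_nth [simp]:
  "(vector [a, b, c, d] :: 'a::zero^4) $ 1 = a"
  "(vector [a, b, c, d] :: 'a::zero^4) $ 2 = b"
  "(vector [a, b, c, d] :: 'a::zero^4) $ 3 = c"
  "(vector [a, b, c, d] :: 'a::zero^4) $ 4 = d"
  by (simp_all add: vector_def)

lemma cmod_coord_le: "cmod (coord1 p) \<le> norm p" "cmod (coord2 p) \<le> norm p"
  unfolding coord1_def coord2_def cmod_def norm_vec_def L2_set_def sum_4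
  by (auto intro!: real_sqrt_le_mono)

lemma bounded_linear_coord1: "bounded_linear coord1"
  using cmod_coord_le
  by (intro bounded_linear_intro[where K = 1]) (auto simp: coord1_def complex_eq_iff)

lemma bounded_linear_coord2: "bounded_linear coord2"
  using cmod_coord_le
  by (intro bounded_linear_intro[where K = 1]) (auto simp: coord2_def complex_eq_iff)

lemma J\<^sub>0_almost_complex: "almost_complex_structure bidisc J\<^sub>0"
proof -
  have "open bidisc"
    unfolding bidisc_def mem_ball_0
    by (intro open_Collect_conj open_Collect_less continuous_intros
        linear_continuous_on bounded_linear_coord1 bounded_linear_coord2)
  \<comment> \<open>The off-diagonal term is antilinear in \<open>a\<close>, hence anticommutes with
    multiplication by \<i> and cancels from the square.\<close>
  moreover have "J\<^sub>0 p ** J\<^sub>0 p = - mat 1" for p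
    by (simp add: vec_eq_iff forall_4 J\<^sub>0_def matrix_matrix_mult_def sum_4 mat_def)
  ultimately show ?thesis
    by (simp add: almost_complex_structure_def)
qed

text \<open>Subadditivity of the square root, the source of the exponent 1/2.\<close>

lemma abs_sqrt_diff_le: "\<bar>sqrt x - sqrt y\<bar> \<le> sqrt \<bar>x - y\<bar>" if "0 \<le> x" "0 \<le> y"
proof -
  have *: "sqrt x - sqrt y \<le> sqrt (x - y)" if "0 \<le> y" "y \<le> x" for x y :: real
    using sqrt_add_le_add_sqrt[of y "x - y"] that by simp
  show ?thesis
    using *[of y x] *[of x y] that by (cases "x \<le> y") (auto simp: abs_if)
qed

lemma J\<^sub>0_Hoelder: "Hoelder_structure bidisc (1/2) J\<^sub>0"
proof -
  have k: "\<bar>skew p - skew q\<bar> \<le> 2 * 10^6 * dist p q powr (1/2)" for p q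
  proof -
    have "\<bar>sqrt (cmod (coord2 p)) - sqrt (cmod (coord2 q))\<bar> \<le> sqrt \<bar>cmod (coord2 p) - cmod (coord2 q)\<bar>"
      by (rule abs_sqrt_diff_le) auto
    also have "\<dots> \<le> sqrt (cmod (coord2 (p - q)))"
      using norm_triangle_ineq3[of "coord2 p" "coord2 q"]
      by (simp add: linear_diff[OF bounded_linear.linear[OF bounded_linear_coord2]])
    also have "\<dots> \<le> dist p q powr (1/2)"
      using cmod_coord_le(2)[of "p - q"] by (simp add: powr_half_sqrt dist_norm)
    finally show ?thesis
      unfolding skew_def right_diff_distrib[symmetric] abs_mult by simp
  qed
  \<comment> \<open>One bound for all sixteen entries: two equal \<open>- skew\<close>, the others
    are constant. It holds globally, so radius 1 serves at every point.\<close>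
  define K where "K p q = 2 * 10^6 * dist p q powr (1/2)" for p q :: "real^4"
  have k': "\<bar>skew q - skew p\<bar> \<le> K p q" "0 \<le> K p q" for p q
    using k[of p q] by (auto simp: K_def abs_minus_commute)
  have "\<forall>i j. dist (J\<^sub>0 p $ i $ j) (J\<^sub>0 q $ i $ j) \<le> K p q" for p q
    unfolding forall_4 by (simp add: J\<^sub>0_def dist_real_def k')
  then show ?thesis
    unfolding Hoelder_structure_def locally_Hoelder_on_def
    unfolding K_def by (meson zero_less_one)
qed

section \<open>Pseudoholomorphic discs in complex coordinates\<close>

lemma J\<^sub>0_coords:
  "coord1 (J\<^sub>0 p *v V) = \<i> * coord1 V"
  "coord2 (J\<^sub>0 p *v V) = \<i> * coord2 V - \<i> * of_real (skew p) * cnj (coord1 V)"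
  by (simp_all add: coord1_def coord2_def J\<^sub>0_def matrix_vector_mult_def sum_4 complex_eq_iff)

text \<open>The first coordinate is a bounded holomorphic function with derivative 1 at the centre,
  so its derivative stays near 1 on a disc of fixed size; the second coordinate then satisfies the
  hypotheses of \<open>dbar_sqrt_zero_at_centre\<close>.\<close>

lemma J\<^sub>0_disc_in_axis:
  assumes hol: "J_holomorphic bidisc J\<^sub>0 r Z" and r: "1 / 2 < r"
    and start: "coord1 (partial_x Z 0) = 1"
  shows "coord2 (Z 0) = 0"
proof -
  obtain Z' where cont_Z': "continuous_on (ball 0 r) Z'"
    and der_Z: "\<And>z. z \<in> ball 0 r \<Longrightarrow> (Z has_derivative blinfun_apply (Z' z)) (at z)"
    using hol by (auto simp: J_holomorphic_def C1_on_def)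
  have Z_in: "cmod (coord1 (Z z)) < 1" "cmod (coord2 (Z z)) < 1" if "z \<in> ball 0 r" for z
  proof -
    have "Z z \<in> bidisc" using hol that unfolding J_holomorphic_def by blast
    then show "cmod (coord1 (Z z)) < 1" "cmod (coord2 (Z z)) < 1" by (auto simp: bidisc_def)
  qed
  have partials: "partial_x Z z = Z' z 1" "partial_y Z z = Z' z \<i>" if "z \<in> ball 0 r" for z
    using frechet_derivative_at[OF der_Z[OF that]] by (simp_all add: partial_x_def partial_y_def)
  have eq: "Z' z \<i> = J\<^sub>0 (Z z) *v Z' z 1" if "z \<in> ball 0 r" for z
    using hol that partials[OF that] by (auto simp: J_holomorphic_def)

  define f where "f z = coord1 (Z z)" for z
  define w where "w z = coord2 (Z z)" for z
  define g where "g z = coord1 (Z' z 1)" for z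
  define w' where "w' z = Blinfun coord2 o\<^sub>L Z' z" for z
  have w'_apply: "blinfun_apply (w' z) h = coord2 (Z' z h)" for z h
    by (simp add: w'_def bounded_linear_Blinfun_apply[OF bounded_linear_coord2])
  have der_w: "(w has_derivative blinfun_apply (w' z)) (at z)" if "z \<in> ball 0 r" for z
    using bounded_linear.has_derivative[OF bounded_linear_coord2 der_Z[OF that]]
    by (simp add: w_def[abs_def] w'_apply[abs_def])
  have cont_w': "continuous_on (ball 0 r) w'"
    unfolding w'_def
    by (intro bounded_bilinear.continuous_on[OF bounded_bilinear_blinfun_compose]
        continuous_on_const cont_Z')
  \<comment> \<open>The \<i>-linear parts cancel in \<open>dbar\<close>, leaving half of
    \<open>skew\<close> times \<open>cnj (g z)\<close>; this explains the factor 2 in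
    \<open>skew\<close>.\<close>
  have dbar_w: "dbar (w' z) = of_real (10^6 * sqrt (cmod (w z))) * cnj (g z)" if "z \<in> ball 0 r" for z
    by (simp add: dbar_def w'_apply eq[OF that] J\<^sub>0_coords g_def w_def skew_def algebra_simps)

  have der_f: "(f has_field_derivative g z) (at z)" if "z \<in> ball 0 r" for z
  proof -
    let ?L = "Blinfun coord1 o\<^sub>L Z' z"
    have L: "blinfun_apply ?L h = coord1 (Z' z h)" for h
      by (simp add: bounded_linear_Blinfun_apply[OF bounded_linear_coord1])
    have "coord1 (Z' z h) = g z * h" for h
      using blinfun_complex_expand[of ?L h] unfolding L eq[OF that] J\<^sub>0_coords
      by (simp add: g_def complex_eq_iff algebra_simps)
    with bounded_linear.has_derivative[OF bounded_linear_coord1 der_Z[OF that]] show ?thesis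
      by (simp add: has_field_derivative_def f_def[abs_def])
  qed
  then have hol_f: "f holomorphic_on ball 0 r"
    unfolding holomorphic_on_open[OF open_ball] by blast
  have deriv_f: "deriv f z = g z" if "z \<in> ball 0 r" for z
    by (rule DERIV_imp_deriv[OF der_f[OF that]])
  \<comment> \<open>Cauchy's estimate on circles of radius 1/4, contained in the domain since 1/64 +
    1/4 < 1/2 < \<open>r\<close>, bounds the second derivative by \<open>2 / (1/4)^2 = 32\<close>.
    Over a distance 1/64 the derivative moves by at most 1/2, which gives the constants 1/2 and 3/2
    required below.\<close>
  have g_near_1: "cmod (g z - 1) \<le> 1 / 2" if z: "z \<in> ball 0 (1/64)" for z
  proof -
    have "cmod (deriv f z - deriv f 0) \<le> 32 * cmod (z - 0)"
    proof (rule field_differentiable_bound[OF convex_ball[of 0 "1/64"]])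
      fix u :: complex assume u: "u \<in> ball 0 (1/64)"
      have "u \<in> ball 0 r" using u r by auto
      then show "(deriv f has_field_derivative deriv (deriv f) u) (at u within ball 0 (1/64))"
        by (rule has_field_derivative_at_within
            [OF holomorphic_derivI[OF holomorphic_deriv[OF hol_f open_ball] open_ball]])
      have sub: "cball u (1/4) \<subseteq> ball 0 r"
      proof
        fix x assume "x \<in> cball u (1/4)"
        then show "x \<in> ball 0 r"
          using u r norm_triangle_ineq2[of x u] by (auto simp: dist_norm norm_minus_commute)
      qed
      have "cmod ((deriv ^^ 2) f u) \<le> fact 2 * 1 / (1/4) ^ 2"
      proof (rule Cauchy_inequality)
        show "f holomorphic_on ball u (1/4)"
          using sub by (intro holomorphic_on_subset[OF hol_f]) auto
        show "continuous_on (cball u (1/4)) f"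
          using sub by (intro holomorphic_on_imp_continuous_on holomorphic_on_subset[OF hol_f]) auto
        fix x assume "cmod (u - x) = 1/4"
        then have "x \<in> cball u (1/4)" by (simp add: dist_norm)
        then have "x \<in> ball 0 r" using sub by blast
        then show "cmod (f x) \<le> 1"
          using Z_in by (auto simp: f_def less_imp_le)
      qed simp
      then show "cmod (deriv (deriv f) u) \<le> 32"
        by (simp add: numeral_2_eq_2)
    qed (use z in auto)
    moreover have "g 0 = 1"
      using start partials[of 0] r by (simp add: g_def)
    ultimately show ?thesis
      using z r deriv_f[of z] deriv_f[of 0] by simp
  qed

  have sub: "z \<in> ball 0 r" if "z \<in> ball 0 (1/64)" for z :: complex
    using that r by simp
  have "w 0 = 0"
  proof (rule dbar_sqrt_zero_at_centre)
    show "continuous_on (ball 0 (1/64)) w'"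
      using sub by (intro continuous_on_subset[OF cont_w']) auto
    fix z :: complex assume z: "z \<in> ball 0 (1/64)"
    show "(w has_derivative blinfun_apply (w' z)) (at z)"
      by (rule der_w[OF sub[OF z]])
    show "cmod (w z) \<le> 1"
      using Z_in[OF sub[OF z]] by (simp add: w_def)
    let ?k = "10^6 * sqrt (cmod (w z))"
    have "1 / 2 \<le> Re (g z)"
      using g_near_1[OF z] abs_Re_le_cmod[of "g z - 1"] by simp
    from mult_left_mono[OF this, of ?k]
    show "?k / 2 \<le> Re (dbar (w' z))"
      unfolding dbar_w[OF sub[OF z]] by simp
    have "cmod (g z) \<le> 3 / 2"
      using g_near_1[OF z] norm_triangle_ineq[of "g z - 1" 1] by simp
    from mult_left_mono[OF this, of ?k]
    show "cmod (dbar (w' z)) \<le> 3 / 2 * ?k"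
      unfolding dbar_w[OF sub[OF z]] by (simp add: norm_mult)
  qed
  then show ?thesis by (simp add: w_def)
qed

section \<open>The disc in the axis and the failure of upper semicontinuity\<close>

definition axis_disc :: "complex \<Rightarrow> real^4" where
  "axis_disc z = vector [Re z, Im z, 0, 0]"

lemma axis_disc_coords [simp]: "coord1 (axis_disc z) = z" "coord2 (axis_disc z) = 0"
  by (simp_all add: coord1_def coord2_def axis_disc_def complex_eq_iff)

lemma bounded_linear_axis_disc: "bounded_linear axis_disc"
  by (rule bounded_linear_intro[where K = 1])
     (simp_all add: vec_eq_iff forall_4 axis_disc_def cmod_def norm_vec_def L2_set_def sum_4)

text \<open>On the axis \<open>skew\<close> vanishes, so \<open>J\<^sub>0\<close> is the standard
  structure there and the linear embedding is holomorphic.\<close>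

lemma axis_disc_J_holomorphic: "J_holomorphic bidisc J\<^sub>0 1 axis_disc"
proof -
  have der: "(axis_disc has_derivative axis_disc) (at z)" for z
    by (rule bounded_linear_imp_has_derivative[OF bounded_linear_axis_disc])
  have "C1_on (ball 0 1) axis_disc"
    unfolding C1_on_def
    by (rule exI[of _ "\<lambda>_. Blinfun axis_disc"])
       (simp add: bounded_linear_Blinfun_apply[OF bounded_linear_axis_disc] der)
  moreover have "axis_disc \<i> = J\<^sub>0 (axis_disc z) *v axis_disc 1" for z
    by (simp add: vec_eq_iff forall_4 J\<^sub>0_def skew_def matrix_vector_mult_def sum_4 axis_disc_def coord2_def complex_eq_iff)
  ultimately show ?thesis
    using frechet_derivative_at[OF der]
    by (auto simp: J_holomorphic_def bidisc_def partial_x_def partial_y_def)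
qed

theorem theorem1:
  shows "\<exists>J :: real^4 \<Rightarrow> real^4^4.
    almost_complex_structure bidisc J \<and>
    Hoelder_structure bidisc (1/2) J \<and>
    \<not> upper_semicontinuous_on (bidisc \<times> UNIV) (\<lambda>(p, V). royden_kobayashi bidisc J p V)"
proof (intro exI conjI notI)
  show "almost_complex_structure bidisc J\<^sub>0" by (rule J\<^sub>0_almost_complex)
  show "Hoelder_structure bidisc (1/2) J\<^sub>0" by (rule J\<^sub>0_Hoelder)
  let ?F = "\<lambda>(p, V). royden_kobayashi bidisc J\<^sub>0 p V"
  let ?V = "axis_disc 1"
  assume usc: "upper_semicontinuous_on (bidisc \<times> UNIV) ?F"
  have zero: "axis_disc 0 = 0"
    by (rule linear_0[OF bounded_linear.linear[OF bounded_linear_axis_disc]])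
  have "partial_x axis_disc 0 = ?V"
    using frechet_derivative_at[OF bounded_linear_imp_has_derivative[OF bounded_linear_axis_disc], of 0]
    by (simp add: partial_x_def)
  then have "royden_kobayashi bidisc J\<^sub>0 0 ?V \<le> ereal (1 / 1)"
    unfolding royden_kobayashi_def
    using axis_disc_J_holomorphic zero by (intro Inf_lower) force
  also have "\<dots> < 2" by simp
  \<comment> \<open>The threshold 2 corresponds to radius 1/2: a pseudo-norm below 2 provides a disc
    of radius larger than 1/2, as \<open>J\<^sub>0_disc_in_axis\<close> requires.\<close>
  finally have "?F (0, ?V) < 2" by simp
  moreover have "(0, ?V) \<in> bidisc \<times> UNIV"
    by (simp add: bidisc_def coord1_def coord2_def Complex_eq)
  ultimately have "\<forall>\<^sub>F y in at (0, ?V) within bidisc \<times> UNIV. ?F y < 2"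
    using usc by (simp only: upper_semicontinuous_on_def)
  then obtain d where d: "0 < d" and near:
    "\<And>y. y \<in> bidisc \<times> UNIV \<Longrightarrow> y \<noteq> (0, ?V) \<Longrightarrow> dist y (0, ?V) < d \<Longrightarrow> ?F y < 2"
    unfolding eventually_at by auto
  \<comment> \<open>The test point is \<open>(0, e)\<close> in complex coordinates (the third real
    coordinate is the real part of the second complex one), off the axis, inside the bidisc and
    within \<open>d\<close> of the origin; the vector is kept fixed.\<close>
  define e where "e = min (1/2) (d / 2)"
  have e: "0 < e" "e < 1" "e < d" using d by (auto simp: e_def)
  define p :: "real^4" where "p = axis 3 e"
  have p: "coord1 p = 0" "coord2 p = of_real e" "norm p = e"
    using e by (auto simp: p_def coord1_def coord2_def axis_def complex_eq_iff norm_vec_def L2_set_def sum_4)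
  have "?F (p, ?V) < 2"
  proof (rule near)
    show "(p, ?V) \<in> bidisc \<times> UNIV" "(p, ?V) \<noteq> (0, ?V)" "dist (p, ?V) (0, ?V) < d"
      using p e by (auto simp: bidisc_def dist_Pair_Pair)
  qed
  then obtain r Z where rZ: "0 < r" "ereal (1 / r) < 2" "J_holomorphic bidisc J\<^sub>0 r Z"
    "Z 0 = p" "partial_x Z 0 = ?V"
    unfolding royden_kobayashi_def by (auto simp: Inf_less_iff)
  have "1 / r < 2" using rZ(2) by simp
  then have "1 / 2 < r" using rZ(1) by (simp add: field_simps)
  from J\<^sub>0_disc_in_axis[OF rZ(3) this] rZ(4,5) p e show False
    by simp
qed

end
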